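(* Let $K$ be a field of characteristic $\neq 2$ and let $\mathcal{E}=I_1\oplus I_2$ be a decomposable power-associative nil evolution $K$-algebra, where $I_1,I_2$ are nonzero ideals. For a derivation $d$ of $\mathcal{E}$ let $(f_d,g_d,\ell_d,k_d)$ be the unique quadruple of linear maps associated with $d$. Let $d$ and $d'$ be two derivations of $\mathcal{E}$. Then the unique quadruple $(f_{[d,d']},g_{[d,d']},\ell_{[d,d']},k_{[d,d']})$ associated with the derivation $[d,d']$ satisfies: (i) $f_{[d,d']}=[f_d,f_{d'}]+(k_d\circ\ell_{d'}-k_{d'}\circ\ell_d)$; (ii) $\ell_{[d,d']}=(\ell_d\circ f_{d'}-\ell_{d'}\circ f_d)+(g_d\circ\ell_{d'}-g_{d'}\circ\ell_d)$; (iii) $g_{[d,d']}=[g_d,g_{d'}]+(\ell_d\circ k_{d'}-\ell_{d'}\circ k_d)$; (iv) $k_{[d,d']}=(k_d\circ g_{d'}-k_{d'}\circ g_d)+(f_d\circ k_{d'}-f_{d'}\circ k_d)$.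
   Context: An evolution $K$-algebra is a finite-dimensional commutative (not necessarily associative) $K$-algebra having a basis $\{e_1,\dots,e_n\}$ with $e_ie_j=0$ for $i\ne j$. It is power-associative if every subalgebra generated by one element is associative, and nil if for every $a$ some power $a^m$ is $0$ ($a^1=a$, $a^{k+1}=a^ka$). An algebra is decomposable if it is the direct sum of two nonzero ideals. A derivation of an algebra $A$ is a linear map $d:A\to A$ with $d(uv)=ud(v)+d(u)v$; the bracket of linear endomorphisms is $[d,d']=d\circ d'-d'\circ d$. The quadruple associated with a derivation $d$ of $\mathcal{E}=I_1\oplus I_2$ consists of the linear maps $f_d:I_1\to I_1$, $\ell_d:I_1\to I_2$, $g_d:I_2\to I_2$, $k_d:I_2\to I_1$ determined by $d(x_1)=f_d(x_1)+\ell_d(x_1)$ for $x_1\in I_1$ and $d(x_2)=g_d(x_2)+k_d(x_2)$ for $x_2\in I_2$. *)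

theory Defs
  imports Complex_Main "HOL-Library.FuncSet"
begin

locale comm_algebra = vector_space scale
  for scale :: "'k::field \<Rightarrow> 'a::ab_group_add \<Rightarrow> 'a" (infixr \<open>*s\<close> 75) +
  fixes mul :: "'a \<Rightarrow> 'a \<Rightarrow> 'a" (infixl \<open>\<bullet>\<close> 70)
  assumes mul_commute: "x \<bullet> y = y \<bullet> x"
    and mul_add_left: "(x + y) \<bullet> z = x \<bullet> z + y \<bullet> z"
    and mul_scale_left: "(c *s x) \<bullet> y = c *s (x \<bullet> y)"
begin

definition subalgebra :: "'a set \<Rightarrow> bool" where
  "subalgebra S \<longleftrightarrow> subspace S \<and> (\<forall>x\<in>S. \<forall>y\<in>S. x \<bullet> y \<in> S)"

definition subalgebra_generated_by :: "'a \<Rightarrow> 'a set" where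
  "subalgebra_generated_by a = \<Inter> {S. subalgebra S \<and> a \<in> S}"

definition power_associative :: bool where
  "power_associative \<longleftrightarrow>
    (\<forall>a. \<forall>x \<in> subalgebra_generated_by a. \<forall>y \<in> subalgebra_generated_by a.
      \<forall>z \<in> subalgebra_generated_by a. (x \<bullet> y) \<bullet> z = x \<bullet> (y \<bullet> z))"

text \<open>The powers start at exponent 1, as the algebra need not have a unit; the value at
  exponent 0 is irrelevant.\<close>

definition alg_power :: "'a \<Rightarrow> nat \<Rightarrow> 'a" where
  "alg_power a m = ((\<lambda>x. x \<bullet> a) ^^ (m - 1)) a"

lemma alg_power_1: "alg_power a 1 = a"
  by (simp add: alg_power_def)

lemma alg_power_Suc: "k \<ge> 1 \<Longrightarrow> alg_power a (k + 1) = alg_power a k \<bullet> a"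
  by (cases k) (simp_all add: alg_power_def)

definition nil_algebra :: bool where
  "nil_algebra \<longleftrightarrow> (\<forall>a. \<exists>m\<ge>1. alg_power a m = 0)"

definition ideal :: "'a set \<Rightarrow> bool" where
  "ideal I \<longleftrightarrow> subspace I \<and> (\<forall>x\<in>I. \<forall>y. x \<bullet> y \<in> I \<and> y \<bullet> x \<in> I)"

definition direct_sum_of_nonzero_ideals :: "'a set \<Rightarrow> 'a set \<Rightarrow> bool" where
  "direct_sum_of_nonzero_ideals I J \<longleftrightarrow>
    ideal I \<and> ideal J \<and> I \<noteq> {0} \<and> J \<noteq> {0} \<and> I \<inter> J = {0} \<and> {x + y | x y. x \<in> I \<and> y \<in> J} = UNIV"

definition derivation :: "('a \<Rightarrow> 'a) \<Rightarrow> bool" where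
  "derivation d \<longleftrightarrow>
    Vector_Spaces.linear scale scale d \<and> (\<forall>u v. d (u \<bullet> v) = u \<bullet> d v + d u \<bullet> v)"

end

locale evolution_algebra = comm_algebra +
  assumes natural_basis: "\<exists>B. finite B \<and> independent B \<and> span B = UNIV \<and>
    (\<forall>x\<in>B. \<forall>y\<in>B. x \<noteq> y \<longrightarrow> x \<bullet> y = 0)"

definition bracket :: "('a::ab_group_add \<Rightarrow> 'a) \<Rightarrow> ('a \<Rightarrow> 'a) \<Rightarrow> 'a \<Rightarrow> 'a" where
  "bracket d d' = (\<lambda>x. (d \<circ> d') x - (d' \<circ> d) x)"

context comm_algebra
begin

text \<open>Linear maps between subspaces are functions that take the value \<^const>\<open>undefined\<close>
  outside their domain, so that a linear map is determined by its values on the domain.\<close>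

definition linear_between :: "'a set \<Rightarrow> 'a set \<Rightarrow> ('a \<Rightarrow> 'a) \<Rightarrow> bool" where
  "linear_between S T f \<longleftrightarrow> f \<in> S \<rightarrow>\<^sub>E T \<and>
    (\<forall>x\<in>S. \<forall>y\<in>S. f (x + y) = f x + f y) \<and> (\<forall>c. \<forall>x\<in>S. f (c *s x) = c *s f x)"

text \<open>The components are listed in the order $(f, g, \ell, k)$.\<close>

definition is_quadruple ::
    "'a set \<Rightarrow> 'a set \<Rightarrow> ('a \<Rightarrow> 'a) \<Rightarrow>
      ('a \<Rightarrow> 'a) \<times> ('a \<Rightarrow> 'a) \<times> ('a \<Rightarrow> 'a) \<times> ('a \<Rightarrow> 'a) \<Rightarrow> bool" where
  "is_quadruple I1 I2 d = (\<lambda>(f, g, l, k).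
    linear_between I1 I1 f \<and> linear_between I2 I2 g \<and>
    linear_between I1 I2 l \<and> linear_between I2 I1 k \<and>
    (\<forall>x\<in>I1. d x = f x + l x) \<and> (\<forall>x\<in>I2. d x = g x + k x))"

definition quadruple ::
    "'a set \<Rightarrow> 'a set \<Rightarrow> ('a \<Rightarrow> 'a) \<Rightarrow>
      ('a \<Rightarrow> 'a) \<times> ('a \<Rightarrow> 'a) \<times> ('a \<Rightarrow> 'a) \<times> ('a \<Rightarrow> 'a)" where
  "quadruple I1 I2 d = (THE q. is_quadruple I1 I2 d q)"

lemma quadruple_exists_unique:
  assumes dec: "direct_sum_of_nonzero_ideals I1 I2"
    and lin: "Vector_Spaces.linear scale scale d"
  shows "\<exists>!q. is_quadruple I1 I2 d q"
proof -
  have sub: "subspace I1" "subspace I2" and disj: "I1 \<inter> I2 = {0}"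
    and sum: "{x + y | x y. x \<in> I1 \<and> y \<in> I2} = UNIV"
    using dec by (auto simp: direct_sum_of_nonzero_ideals_def ideal_def)
  have uniq: "a = a' \<and> b = b'"
    if "a \<in> I1" "a' \<in> I1" "b \<in> I2" "b' \<in> I2" "a + b = a' + b'" for a a' b b'
  proof -
    have "a - a' = b' - b"
      using that(5) by (simp add: algebra_simps)
    moreover have "a - a' \<in> I1" "b' - b \<in> I2"
      using that sub by (auto intro: subspace_diff)
    ultimately have "a - a' \<in> I1 \<inter> I2"
      by simp
    then show ?thesis
      using disj that(5) by simp
  qed
  have "\<exists>y z. y \<in> I1 \<and> z \<in> I2 \<and> y + z = x" for x
  proof -
    have "x \<in> {x + y | x y. x \<in> I1 \<and> y \<in> I2}"
      using sum by simp
    then show ?thesis by auto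
  qed
  then obtain p1 p2 where p: "\<And>x. p1 x \<in> I1" "\<And>x. p2 x \<in> I2" "\<And>x. p1 x + p2 x = x"
    by metis
  have p_add: "p1 (x + y) = p1 x + p1 y \<and> p2 (x + y) = p2 x + p2 y" for x y
  proof (rule uniq)
    have "p1 x + p1 y + (p2 x + p2 y) = (p1 x + p2 x) + (p1 y + p2 y)"
      by (simp only: ac_simps)
    then show "p1 (x + y) + p2 (x + y) = p1 x + p1 y + (p2 x + p2 y)"
      by (simp only: p(3))
  qed (simp_all add: p sub subspace_add)
  have p_scale: "p1 (c *s x) = c *s p1 x \<and> p2 (c *s x) = c *s p2 x" for c x
  proof (rule uniq)
    show "p1 (c *s x) + p2 (c *s x) = c *s p1 x + c *s p2 x"
      by (simp only: p(3) scale_right_distrib[symmetric])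
  qed (simp_all add: p sub subspace_scale)
  interpret d: Vector_Spaces.linear scale scale d by (fact lin)
  have lin1: "linear_between S I1 (restrict (\<lambda>x. p1 (d x)) S)"
    and lin2: "linear_between S I2 (restrict (\<lambda>x. p2 (d x)) S)" if "subspace S" for S
    using that by (simp_all add: linear_between_def subspace_add subspace_scale
        d.add d.scale p p_add p_scale)
  have "is_quadruple I1 I2 d (restrict (\<lambda>x. p1 (d x)) I1, restrict (\<lambda>x. p2 (d x)) I2,
      restrict (\<lambda>x. p2 (d x)) I1, restrict (\<lambda>x. p1 (d x)) I2)"
    using sub by (simp add: is_quadruple_def lin1 lin2 p add.commute[of "p2 _"])
  moreover have "q = q'" if q: "is_quadruple I1 I2 d q" and q': "is_quadruple I1 I2 d q'" for q q'
  proof -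
    obtain f g l k where Q: "q = (f, g, l, k)" by (cases q)
    obtain f' g' l' k' where Q': "q' = (f', g', l', k')" by (cases q')
    have mem: "f \<in> I1 \<rightarrow>\<^sub>E I1" "g \<in> I2 \<rightarrow>\<^sub>E I2" "l \<in> I1 \<rightarrow>\<^sub>E I2" "k \<in> I2 \<rightarrow>\<^sub>E I1"
      "f' \<in> I1 \<rightarrow>\<^sub>E I1" "g' \<in> I2 \<rightarrow>\<^sub>E I2" "l' \<in> I1 \<rightarrow>\<^sub>E I2" "k' \<in> I2 \<rightarrow>\<^sub>E I1"
      using q q' by (auto simp: Q Q' is_quadruple_def linear_between_def)
    have 1: "f x = f' x \<and> l x = l' x" if "x \<in> I1" for x
    proof (rule uniq)
      show "f x + l x = f' x + l' x"
        using q q' that unfolding Q Q' is_quadruple_def by simp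
    qed (insert mem that, simp_all add: PiE_iff)
    have 2: "k x = k' x \<and> g x = g' x" if "x \<in> I2" for x
    proof (rule uniq)
      show "k x + g x = k' x + g' x"
        using q q' that unfolding Q Q' is_quadruple_def
        by (simp add: add.commute)
    qed (insert mem that, simp_all add: PiE_iff)
    have "f = f'"
      by (rule PiE_ext[OF mem(1) mem(5)]) (simp add: 1)
    moreover have "g = g'"
      by (rule PiE_ext[OF mem(2) mem(6)]) (simp add: 2)
    moreover have "l = l'"
      by (rule PiE_ext[OF mem(3) mem(7)]) (simp add: 1)
    moreover have "k = k'"
      by (rule PiE_ext[OF mem(4) mem(8)]) (simp add: 2)
    ultimately show ?thesis by (simp add: Q Q')
  qed
  ultimately show ?thesis by blast
qed

lemma derivation_bracket:
  assumes "derivation d" "derivation d'"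
  shows "derivation (bracket d d')"
proof -
  interpret d: Vector_Spaces.linear scale scale d
    using assms by (simp add: derivation_def)
  interpret d': Vector_Spaces.linear scale scale d'
    using assms by (simp add: derivation_def)
  have mul_add_right: "x \<bullet> (y + z) = x \<bullet> y + x \<bullet> z" for x y z
    by (metis mul_commute mul_add_left)
  have mul_diff_left: "(x - y) \<bullet> z = x \<bullet> z - y \<bullet> z" for x y z
    using mul_add_left[of "x - y" y z] by (simp add: algebra_simps)
  have mul_diff_right: "z \<bullet> (x - y) = z \<bullet> x - z \<bullet> y" for x y z
    by (metis mul_commute mul_diff_left)
  have "Vector_Spaces.linear scale scale (bracket d d')"
    by unfold_locales (simp_all add: bracket_def d.add d'.add d.scale d'.scale algebra_simps)
  moreover have "bracket d d' (u \<bullet> v) = u \<bullet> bracket d d' v + bracket d d' u \<bullet> v" for u v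
  proof -
    have "d (u \<bullet> v) = u \<bullet> d v + d u \<bullet> v" "d' (u \<bullet> v) = u \<bullet> d' v + d' u \<bullet> v" for u v
      using assms by (auto simp: derivation_def)
    then show ?thesis
      by (simp add: bracket_def d.add d'.add mul_diff_left mul_diff_right algebra_simps)
  qed
  ultimately show ?thesis by (simp add: derivation_def)
qed

end

end

theory Submission
  imports Defs
begin

text \<open>The quadruple of a derivation is its block matrix with respect to
  \<open>I1 \<oplus> I2\<close>, with columns \<open>(f, l)\<close> and \<open>(k, g)\<close>. Composition of linear maps is
  multiplication of block matrices (\<open>is_quadruple_comp\<close>), so the four formulas are the four
  blocks of \<open>M M' - M' M\<close>. The bracket is again a derivation, hence has a quadruple, and
  directness of the sum (\<open>direct_sum_unique\<close>) allows comparing the components in \<open>I1\<close> and in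
  \<open>I2\<close> separately (\<open>is_quadruple_bracket\<close>). Exchanging the two summands turns
  \<open>(f, g, l, k)\<close> into \<open>(g, f, k, l)\<close>, so the formulas for \<open>g\<close> and \<open>k\<close> on \<open>I2\<close> are those
  for \<open>f\<close> and \<open>l\<close> with the roles of the summands exchanged.\<close>

context comm_algebra
begin

lemma direct_sum_unique:
  assumes "subspace S" "subspace T" "S \<inter> T = {0}"
    and "a \<in> S" "a' \<in> S" "b \<in> T" "b' \<in> T" "a + b = a' + b'"
  shows "a = a'" "b = b'"
proof -
  have eq: "a - a' = b' - b"
    using assms(8) by (simp add: algebra_simps)
  have "a - a' \<in> S" "b' - b \<in> T"
    using assms by (auto intro: subspace_diff)
  then have "a - a' \<in> S \<inter> T"
    using eq by simp
  then have "a - a' = 0"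
    unfolding assms(3) by simp
  with eq show "a = a'" "b = b'"
    by auto
qed

lemma is_quadruple_quadruple:
  assumes "direct_sum_of_nonzero_ideals I1 I2" "derivation d"
  shows "is_quadruple I1 I2 d (quadruple I1 I2 d)"
  unfolding quadruple_def
  by (rule theI'[OF quadruple_exists_unique]) (use assms in \<open>simp_all add: derivation_def\<close>)

lemma is_quadruple_swap:
  "is_quadruple I1 I2 d (f, g, l, k) \<Longrightarrow> is_quadruple I2 I1 d (g, f, k, l)"
  by (simp add: is_quadruple_def)

lemma is_quadruple_apply:
  assumes "is_quadruple I1 I2 d (f, g, l, k)" "x \<in> I1"
  shows "f x \<in> I1" "l x \<in> I2" "d x = f x + l x"
  using assms by (auto simp: is_quadruple_def linear_between_def)

text \<open>The two parenthesised terms are the first column of the product of the block matrices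
  of \<open>d\<close> and \<open>d'\<close>; the second column is the same statement after \<open>is_quadruple_swap\<close>.\<close>

lemma is_quadruple_comp:
  assumes lin: "Vector_Spaces.linear scale scale d"
    and q: "is_quadruple I1 I2 d (f, g, l, k)" and q': "is_quadruple I1 I2 d' (f', g', l', k')"
    and x: "x \<in> I1"
  shows "d (d' x) = (f (f' x) + k (l' x)) + (l (f' x) + g (l' x))"
proof -
  interpret d: Vector_Spaces.linear scale scale d by (fact lin)
  note x' = is_quadruple_apply[OF q' x]
  have "d (d' x) = d (f' x) + d (l' x)"
    by (simp add: x'(3) d.add)
  also have "d (f' x) = f (f' x) + l (f' x)"
    by (rule is_quadruple_apply(3)[OF q x'(1)])
  also have "d (l' x) = g (l' x) + k (l' x)"
    by (rule is_quadruple_apply(3)[OF is_quadruple_swap[OF q] x'(2)])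
  finally show ?thesis
    by (simp add: ac_simps)
qed

text \<open>Only the first column of the commutator is treated: the second one is the instance for
  the swapped quadruples.\<close>

lemma is_quadruple_bracket:
  assumes sub: "subspace I1" "subspace I2" and disj: "I1 \<inter> I2 = {0}"
    and lin: "Vector_Spaces.linear scale scale d" "Vector_Spaces.linear scale scale d'"
    and q: "is_quadruple I1 I2 d (f, g, l, k)" and q': "is_quadruple I1 I2 d' (f', g', l', k')"
    and q'': "is_quadruple I1 I2 (bracket d d') (f'', g'', l'', k'')"
    and x: "x \<in> I1"
  shows "f'' x = bracket f f' x + ((k \<circ> l') x - (k' \<circ> l) x)"
    and "l'' x = ((l \<circ> f') x - (l' \<circ> f) x) + ((g \<circ> l') x - (g' \<circ> l) x)"
proof -
  note swap = is_quadruple_swap[OF q] is_quadruple_swap[OF q']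
  note mem = is_quadruple_apply(1,2)[OF q] is_quadruple_apply(1,2)[OF q']
    is_quadruple_apply(1,2)[OF q''] is_quadruple_apply(1,2)[OF swap(1)]
    is_quadruple_apply(1,2)[OF swap(2)]
  have in1: "bracket f f' x + ((k \<circ> l') x - (k' \<circ> l) x) \<in> I1"
    unfolding bracket_def comp_def
    by (intro subspace_add subspace_diff sub mem x)
  have in2: "((l \<circ> f') x - (l' \<circ> f) x) + ((g \<circ> l') x - (g' \<circ> l) x) \<in> I2"
    unfolding comp_def
    by (intro subspace_add subspace_diff sub mem x)
  have "f'' x + l'' x = d (d' x) - d' (d x)"
    using is_quadruple_apply(3)[OF q'' x] by (simp add: bracket_def)
  also have "\<dots> = (bracket f f' x + ((k \<circ> l') x - (k' \<circ> l) x))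
      + (((l \<circ> f') x - (l' \<circ> f) x) + ((g \<circ> l') x - (g' \<circ> l) x))"
    unfolding is_quadruple_comp[OF lin(1) q q' x] is_quadruple_comp[OF lin(2) q' q x]
    by (simp add: bracket_def algebra_simps)
  finally have eq: "f'' x + l'' x = \<dots>" .
  show "f'' x = bracket f f' x + ((k \<circ> l') x - (k' \<circ> l) x)"
    and "l'' x = ((l \<circ> f') x - (l' \<circ> f) x) + ((g \<circ> l') x - (g' \<circ> l) x)"
    by (rule direct_sum_unique[OF sub disj mem(5)[OF x] in1 mem(6)[OF x] in2 eq])+
qed

end

theorem mainTheorem3:
  fixes scale :: "'k::field \<Rightarrow> 'a::ab_group_add \<Rightarrow> 'a"
    and mul :: "'a \<Rightarrow> 'a \<Rightarrow> 'a"
    and I1 I2 :: "'a set"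
    and d d' f g l k f' g' l' k' f'' g'' l'' k'' :: "'a \<Rightarrow> 'a"
  assumes "CHAR('k) \<noteq> 2"
    and "evolution_algebra scale mul"
    and "comm_algebra.power_associative scale mul"
    and "comm_algebra.nil_algebra mul"
    and "comm_algebra.direct_sum_of_nonzero_ideals scale mul I1 I2"
    and "comm_algebra.derivation scale mul d"
    and "comm_algebra.derivation scale mul d'"
    and "comm_algebra.quadruple scale I1 I2 d = (f, g, l, k)"
    and "comm_algebra.quadruple scale I1 I2 d' = (f', g', l', k')"
    and "comm_algebra.quadruple scale I1 I2 (bracket d d') = (f'', g'', l'', k'')"
  shows "(\<forall>x\<in>I1. f'' x = bracket f f' x + ((k \<circ> l') x - (k' \<circ> l) x))
    \<and> (\<forall>x\<in>I1. l'' x = ((l \<circ> f') x - (l' \<circ> f) x) + ((g \<circ> l') x - (g' \<circ> l) x))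
    \<and> (\<forall>x\<in>I2. g'' x = bracket g g' x + ((l \<circ> k') x - (l' \<circ> k) x))
    \<and> (\<forall>x\<in>I2. k'' x = ((k \<circ> g') x - (k' \<circ> g) x) + ((f \<circ> k') x - (f' \<circ> k) x))"
proof -
  interpret evolution_algebra scale mul by (fact assms(2))
  note dec = assms(5) and der = assms(6,7)
  have sub: "subspace I1" "subspace I2" and disj: "I1 \<inter> I2 = {0}" "I2 \<inter> I1 = {0}"
    using dec by (simp_all add: direct_sum_of_nonzero_ideals_def ideal_def Int_commute)
  have lin: "Vector_Spaces.linear scale scale d" "Vector_Spaces.linear scale scale d'"
    using der by (simp_all add: derivation_def)
  have q: "is_quadruple I1 I2 d (f, g, l, k)"
    using is_quadruple_quadruple[OF dec der(1)] assms(8) by simp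
  have q': "is_quadruple I1 I2 d' (f', g', l', k')"
    using is_quadruple_quadruple[OF dec der(2)] assms(9) by simp
  have q'': "is_quadruple I1 I2 (bracket d d') (f'', g'', l'', k'')"
    using is_quadruple_quadruple[OF dec derivation_bracket[OF der]] assms(10) by simp
  note first = is_quadruple_bracket[OF sub disj(1) lin q q' q'']
  note second = is_quadruple_bracket[OF sub(2,1) disj(2) lin
      is_quadruple_swap[OF q] is_quadruple_swap[OF q'] is_quadruple_swap[OF q'']]
  show ?thesis
    by (intro conjI ballI first second)
qed

end
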